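(* Let $m\ge 1$ be an integer, let $\ell$ be an odd integer, and let $J$, $A$, $B$, $C$, $s$, $\phi$ be as defined in the context. Let $i,j,k,a,b,c\in\mathbb{Z}$. Then $$[A^iB^jC^k,A^aB^bC^c]\equiv A^{e_A}B^{e_B}C^{e_C}\mod Z_1(J),$$ where $Z_1(J)$ is the center of $J$ and $$e_A=2s\ell\{j\phi(a)-\phi(i)b+ic-ka\},$$ $$e_B=2s\ell\{i\phi(b)-\phi(j)a+kb+j(ib-ab-c)\},$$ $$e_C=ib-ja+2s\ell\{\phi(a)(\phi(j)+jb)-\phi(i)(\phi(b)+jb)+ijc-kab\}.$$
   Context: Notation: $[a,b]=a^{-1}b^{-1}ab$, $b^a=a^{-1}ba$ for group elements, $\alpha=1+2^m\ell$, $s=2^{m-1}$. The group is $$J=\langle A,B\mid A^{[A,B]}=A^{\alpha},\ B^{[B,A]}=B^{\alpha},\ A^{2^{3m-1}}=B^{2^{3m-1}}=1\rangle,\qquad C=[A,B].$$ For $n\in\mathbb{Z}$, $\phi(n)=\frac{(n-1)n}{2}$. The congruence $x\equiv y \bmod Z_1(J)$ means $xZ_1(J)=yZ_1(J)$. *)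

theory Defs
  imports "HOL-Algebra.Coset" "HOL-Algebra.Generated_Groups"
begin

section \<open>Free groups and group presentations\<close>

text \<open>
  A word is a list of letters \<open>(x, e)\<close>, where \<open>(x, True)\<close> stands for the generator \<open>x\<close> and
  \<open>(x, False)\<close> for its formal inverse. Elements of the free group are the classes of words
  modulo insertion and deletion of cancelling pairs.
\<close>

type_synonym 'g word = "('g \<times> bool) list"

inductive free_eq :: "'g word \<Rightarrow> 'g word \<Rightarrow> bool" where
  free_refl: "free_eq u u"
| free_sym: "free_eq u v \<Longrightarrow> free_eq v u"
| free_trans: "free_eq u v \<Longrightarrow> free_eq v w \<Longrightarrow> free_eq u w"
| free_cancel: "free_eq (u @ (x, e) # (x, \<not> e) # v) (u @ v)"

definition free_class :: "'g word \<Rightarrow> 'g word set" where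
  "free_class u = {v. free_eq u v}"

definition free_group :: "'g word set monoid" where
  "free_group =
     \<lparr>carrier = range free_class,
      mult = (\<lambda>X Y. \<Union>u\<in>X. \<Union>v\<in>Y. free_class (u @ v)),
      one = free_class []\<rparr>"

definition free_gen :: "'g \<Rightarrow> 'g word set" where
  "free_gen x = free_class [(x, True)]"

definition normal_closure :: "('a, 'b) monoid_scheme \<Rightarrow> 'a set \<Rightarrow> 'a set" where
  "normal_closure G S = \<Inter>{N. N \<lhd> G \<and> S \<subseteq> N}"

text \<open>A pair \<open>(u, v)\<close> of elements of the free group is read as the relation \<open>u = v\<close>.\<close>

definition relator_kernel :: "('g word set \<times> 'g word set) set \<Rightarrow> 'g word set set" where
  "relator_kernel R =
     normal_closure free_group
       ((\<lambda>(u, v). u \<otimes>\<^bsub>free_group\<^esub> inv\<^bsub>free_group\<^esub> v) ` R)"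

definition presented_group :: "('g word set \<times> 'g word set) set \<Rightarrow> 'g word set set monoid" where
  "presented_group R = free_group Mod relator_kernel R"

definition presented_gen :: "('g word set \<times> 'g word set) set \<Rightarrow> 'g \<Rightarrow> 'g word set set" where
  "presented_gen R x = relator_kernel R #>\<^bsub>free_group\<^esub> free_gen x"


section \<open>Commutators, conjugates and the center\<close>

definition commutator :: "('a, 'b) monoid_scheme \<Rightarrow> 'a \<Rightarrow> 'a \<Rightarrow> 'a" where
  "commutator G x y = inv\<^bsub>G\<^esub> x \<otimes>\<^bsub>G\<^esub> inv\<^bsub>G\<^esub> y \<otimes>\<^bsub>G\<^esub> x \<otimes>\<^bsub>G\<^esub> y"

text \<open>\<open>conjugate G x y\<close> is $x^y = y^{-1} x y$.\<close>

definition conjugate :: "('a, 'b) monoid_scheme \<Rightarrow> 'a \<Rightarrow> 'a \<Rightarrow> 'a" where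
  "conjugate G x y = inv\<^bsub>G\<^esub> y \<otimes>\<^bsub>G\<^esub> x \<otimes>\<^bsub>G\<^esub> y"

definition center :: "('a, 'b) monoid_scheme \<Rightarrow> 'a set" where
  "center G = {z \<in> carrier G. \<forall>x\<in>carrier G. z \<otimes>\<^bsub>G\<^esub> x = x \<otimes>\<^bsub>G\<^esub> z}"


section \<open>The group J\<close>

datatype J_letter = LA | LB

definition J_alpha :: "nat \<Rightarrow> int \<Rightarrow> int" where
  "J_alpha m l = 1 + 2 ^ m * l"

definition J_rels :: "nat \<Rightarrow> int \<Rightarrow> (J_letter word set \<times> J_letter word set) set" where
  "J_rels m l =
    (let F = free_group; a = free_gen LA; b = free_gen LB in
      {(conjugate F a (commutator F a b), a [^]\<^bsub>F\<^esub> J_alpha m l),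
       (conjugate F b (commutator F b a), b [^]\<^bsub>F\<^esub> J_alpha m l),
       (a [^]\<^bsub>F\<^esub> ((2::nat) ^ (3 * m - 1)), \<one>\<^bsub>F\<^esub>),
       (b [^]\<^bsub>F\<^esub> ((2::nat) ^ (3 * m - 1)), \<one>\<^bsub>F\<^esub>)})"

definition J_group :: "nat \<Rightarrow> int \<Rightarrow> J_letter word set set monoid" where
  "J_group m l = presented_group (J_rels m l)"

definition J_A :: "nat \<Rightarrow> int \<Rightarrow> J_letter word set set" where
  "J_A m l = presented_gen (J_rels m l) LA"

definition J_B :: "nat \<Rightarrow> int \<Rightarrow> J_letter word set set" where
  "J_B m l = presented_gen (J_rels m l) LB"

text \<open>The division is exact, since \<open>(n - 1) * n\<close> is even.\<close>

definition phi :: "int \<Rightarrow> int" where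
  "phi n = (n - 1) * n div 2"


section \<open>Basic facts\<close>

lemma free_class_eq_iff: "free_class u = free_class v \<longleftrightarrow> free_eq u v"
proof
  assume "free_class u = free_class v"
  then show "free_eq u v"
    unfolding free_class_def using free_refl[of v] by (simp add: set_eq_iff)
next
  assume uv: "free_eq u v"
  have "free_eq u = free_eq v"
    using free_trans[OF uv] free_trans[OF free_sym[OF uv]] by (intro ext) blast
  then show "free_class u = free_class v"
    by (simp add: free_class_def)
qed

lemma free_eq_append_left: "free_eq u v \<Longrightarrow> free_eq (w @ u) (w @ v)"
proof (induction rule: free_eq.induct)
  case (free_cancel u x e v)
  then show ?case using free_eq.free_cancel[of "w @ u" x e v] by simp
next
  case (free_refl u)
  show ?case by (rule free_eq.free_refl)
next
  case (free_sym u v)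
  show ?case by (rule free_eq.free_sym[OF free_sym.IH])
next
  case (free_trans u v w)
  show ?case by (rule free_eq.free_trans[OF free_trans.IH])
qed

lemma free_eq_append_right: "free_eq u v \<Longrightarrow> free_eq (u @ w) (v @ w)"
proof (induction rule: free_eq.induct)
  case (free_cancel u x e v)
  then show ?case using free_eq.free_cancel[of u x e "v @ w"] by simp
next
  case (free_refl u)
  show ?case by (rule free_eq.free_refl)
next
  case (free_sym u v)
  show ?case by (rule free_eq.free_sym[OF free_sym.IH])
next
  case (free_trans u v w)
  show ?case by (rule free_eq.free_trans[OF free_trans.IH])
qed

lemma free_eq_append: "free_eq u u' \<Longrightarrow> free_eq v v' \<Longrightarrow> free_eq (u @ v) (u' @ v')"
  by (meson free_trans free_eq_append_left free_eq_append_right)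

lemma free_group_mult:
  "free_class u \<otimes>\<^bsub>free_group\<^esub> free_class v = free_class (u @ v)"
proof -
  have mem: "w \<in> free_class u \<longleftrightarrow> free_class w = free_class u" for w u :: "'g word"
    unfolding free_class_eq_iff by (auto simp: free_class_def intro: free_sym)
  have eq: "free_class (u' @ v') = free_class (u @ v)"
    if "u' \<in> free_class u" "v' \<in> free_class v" for u' v'
    using that unfolding mem free_class_eq_iff by (rule free_eq_append)
  have "(\<Union>u'\<in>free_class u. \<Union>v'\<in>free_class v. free_class (u' @ v'))
      = (\<Union>u'\<in>free_class u. \<Union>v'\<in>free_class v. free_class (u @ v))"
    by (intro SUP_cong refl eq)
  also have "\<dots> = free_class (u @ v)"
    using mem[of u u] mem[of v v] by blast
  finally show ?thesis
    by (simp add: free_group_def)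
qed

lemma free_eq_inverse_left:
  "free_eq (rev (map (\<lambda>(x, e). (x, \<not> e)) u) @ u) []"
proof (induction u)
  case Nil
  then show ?case by (simp add: free_refl)
next
  case (Cons p u)
  obtain x e where p: "p = (x, e)" by (cases p)
  let ?v = "rev (map (\<lambda>(x, e). (x, \<not> e)) u)"
  have "free_eq (?v @ (x, \<not> e) # (x, \<not> \<not> e) # u) (?v @ u)"
    by (rule free_cancel)
  from free_trans[OF this Cons.IH] show ?case
    by (simp add: p)
qed

lemma free_group_carrier: "carrier free_group = range free_class"
  and free_group_one: "\<one>\<^bsub>free_group\<^esub> = free_class []"
  by (simp_all add: free_group_def)

lemma free_group_is_group: "group (free_group :: 'g word set monoid)"
proof (rule groupI)
  fix X :: "'g word set"
  assume "X \<in> carrier free_group"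
  then obtain u where u: "X = free_class u" by (auto simp: free_group_carrier)
  let ?v = "rev (map (\<lambda>(x, e). (x, \<not> e)) u)"
  have "free_class ?v \<otimes>\<^bsub>free_group\<^esub> X = free_class []"
    by (simp only: u free_group_mult free_class_eq_iff free_eq_inverse_left)
  then show "\<exists>Y\<in>carrier free_group. Y \<otimes>\<^bsub>free_group\<^esub> X = \<one>\<^bsub>free_group\<^esub>"
    by (auto simp: free_group_carrier free_group_one)
qed (auto simp only: free_group_carrier free_group_one free_group_mult image_iff append_assoc
      append_Nil UNIV_I intro!: rangeI)

lemma (in group) normal_closure_normal:
  assumes "S \<subseteq> carrier G"
  shows "normal_closure G S \<lhd> G"
proof -
  let ?\<N> = "{N. N \<lhd> G \<and> S \<subseteq> N}"
  have "carrier G \<lhd> G"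
    by (rule normal_invI[OF subgroup_self]) simp
  then have ne: "?\<N> \<noteq> {}"
    using assms by blast
  have "subgroup (\<Inter>?\<N>) G"
    by (rule subgroups_Inter) (use ne normal_imp_subgroup in blast)+
  moreover have "g \<otimes> h \<otimes> inv g \<in> \<Inter>?\<N>" if "g \<in> carrier G" "h \<in> \<Inter>?\<N>" for g h
    using that by (blast intro: normal.inv_op_closed2)
  ultimately show ?thesis
    unfolding normal_closure_def by (rule normal_invI)
qed

lemma relator_kernel_normal:
  assumes "R \<subseteq> carrier free_group \<times> carrier free_group"
  shows "relator_kernel R \<lhd> free_group"
proof -
  interpret F: group free_group by (rule free_group_is_group)
  show ?thesis
    unfolding relator_kernel_def using assms by (intro F.normal_closure_normal) auto
qed

lemma presented_group_is_group:
  assumes "R \<subseteq> carrier free_group \<times> carrier free_group"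
  shows "group (presented_group R)"
  unfolding presented_group_def
  using relator_kernel_normal[OF assms] by (rule normal.factorgroup_is_group)

lemma free_gen_closed: "free_gen x \<in> carrier free_group"
  by (simp add: free_gen_def free_group_def)

lemma presented_gen_closed: "presented_gen R x \<in> carrier (presented_group R)"
  by (auto simp: presented_gen_def presented_group_def FactGroup_def RCOSETS_def
      intro: free_gen_closed)

lemma J_rels_carrier: "J_rels m l \<subseteq> carrier free_group \<times> carrier free_group"
proof -
  interpret F: group "free_group :: J_letter word set monoid" by (rule free_group_is_group)
  show ?thesis
    by (simp add: J_rels_def Let_def conjugate_def commutator_def free_gen_closed)
qed

lemma J_group_is_group: "group (J_group m l)"
  unfolding J_group_def by (rule presented_group_is_group[OF J_rels_carrier])

lemma J_A_closed: "J_A m l \<in> carrier (J_group m l)"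
  and J_B_closed: "J_B m l \<in> carrier (J_group m l)"
  by (simp_all add: J_A_def J_B_def J_group_def presented_gen_closed)

end

theory Submission
  imports Defs "HOL-Number_Theory.Cong"
begin

text \<open>
  Write \<open>u = 2\<^sup>m l\<close>, so that the relations say that \<open>C\<close> acts on the powers of \<open>A\<close> by
  \<open>A\<^sup>C = A\<^bsup>1+u\<^esup>\<close> and \<open>C\<^sup>-\<^sup>1\<close> acts on the powers of \<open>B\<close> by the same exponent; the
  relations are preserved by exchanging \<open>A\<close> with \<open>B\<close> and \<open>C\<close> with its inverse. Put
  \<open>N = 2\<^bsup>2m-1\<^esup>\<close>. The proof consists of a centrality statement and a computation.

  Centrality: \<open>A\<^sup>N\<close>, \<open>B\<^sup>N\<close> and \<open>C\<^sup>N\<close> are central in \<open>J\<close>. For \<open>C\<^sup>N\<close> the reason is that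
  \<open>1 + u\<close> has order dividing \<open>N\<close> modulo \<open>2\<^bsup>3m-1\<^esup>\<close>, the exponent that kills \<open>A\<close> and \<open>B\<close>
  (\<open>C_pow_commute_A\<close>). For \<open>A\<^sup>N\<close>, the element \<open>C B A\<close> is brought to the shape
  \<open>A B\<^sup>x A\<^sup>y C\<^sup>-\<^sup>u\<close> in two ways, by moving \<open>A\<close> to the left before or after applying the
  relation for \<open>C B\<close>. The comparison puts a power \<open>A\<^sup>f\<close> into the subgroup generated by \<open>B\<close>
  (\<open>power_A_eq_power_B\<close>), and \<open>f\<close> turns out to be an odd multiple of \<open>N\<close>, so that \<open>A\<^sup>N\<close>
  itself is a power of \<open>B\<close> and hence commutes with both generators (\<open>A_pow_commute_B\<close>).

  Computation: modulo the center the three elements therefore have exponent dividing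
  \<open>2(u/2)\<^sup>2\<close>, a multiple of \<open>N\<close>. Exponents may then be read modulo that number, which makes
  \<open>u\<^sup>2\<close> and \<open>u \<phi>(u x)\<close> vanish. What remains is nilpotent of small class: collecting gives
  a closed formula for the product of two elements \<open>A\<^sup>i B\<^sup>j C\<^sup>k\<close> (\<open>normal_form_mult\<close>), the
  crucial case being \<open>B\<^sup>j A\<^sup>a\<close> (\<open>B_pow_A_pow\<close>). With the product formula, the equation
  \<open>x y = y x w\<close> for the proposed value \<open>w\<close> of the commutator is a polynomial identity in the
  exponents (\<open>commutator_normal_form\<close>).
\<close>

section \<open>Powers twisted by a normalizing element\<close>

lemma phi_double: "2 * phi n = n * (n - 1)"
  by (simp add: phi_def algebra_simps)

lemma phi_add: "phi (x + y) = phi x + phi y + x * y"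
proof -
  have "2 * phi (x + y) = 2 * (phi x + phi y + x * y)"
    unfolding distrib_left phi_double by (simp add: algebra_simps)
  then show ?thesis by simp
qed

lemma phi_simps [simp]: "phi 0 = 0" "phi 1 = 0" by (simp_all add: phi_def)

context group
begin

lemma int_pow_eqI:
  fixes M e f :: int
  assumes "x \<in> carrier G" "x [^] M = \<one>" "[e = f] (mod M)"
  shows "x [^] e = x [^] f"
proof -
  obtain t where "e = f + M * t"
    using assms(3) by (metis cong_iff_lin cong_sym mult.commute)
  then show ?thesis
    using assms(1,2) by (simp add: int_pow_mult int_pow_pow[symmetric])
qed

lemma int_pow_commute_twisted:
  fixes n :: int
  assumes c: "x \<in> carrier G" "y \<in> carrier G" "z \<in> carrier G" and eq: "y \<otimes> x = z \<otimes> y"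
  shows "y \<otimes> x [^] n = z [^] n \<otimes> y"
proof (induction n rule: int_induct[where k = 0])
  case base
  show ?case using c by simp
next
  case (step1 n)
  have "y \<otimes> x [^] (n + 1) = (y \<otimes> x [^] n) \<otimes> x"
    using c by (simp add: int_pow_mult m_assoc)
  also have "\<dots> = z [^] n \<otimes> (y \<otimes> x)"
    using c by (simp add: step1 m_assoc)
  also have "\<dots> = z [^] (n + 1) \<otimes> y"
    using c by (simp add: eq int_pow_mult m_assoc)
  finally show ?case .
next
  case (step2 n)
  have "y \<otimes> x [^] (n - 1) \<otimes> x = z [^] (n - 1) \<otimes> y \<otimes> x"
    using c step2 int_pow_mult[of x "n - 1" 1] int_pow_mult[of z "n - 1" 1]
    by (simp add: m_assoc eq)
  then show ?case using c by simp
qed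

lemma inv_commute:
  assumes "x \<in> carrier G" "y \<in> carrier G" "x \<otimes> y = y \<otimes> x"
  shows "inv x \<otimes> y = y \<otimes> inv x"
  using int_pow_commute_twisted[of x y x "- 1"] assms by (simp add: int_pow_neg)

text \<open>
  To first order in \<open>u\<close>, conjugation by \<open>c\<close> raises \<open>x\<close> to the power \<open>1 - u\<close>, so conjugation by
  \<open>c\<^sup>k\<close> raises it to the power \<open>(1 - u)\<^sup>k = 1 - k u\<close>. The exponent is determined only modulo
  \<open>M\<close>, a divisor of \<open>u\<^sup>2\<close>, and is left existential because \<open>x\<^sup>M\<close> need not be trivial. The actions
  of \<open>c\<close> and of its inverse are both assumed, since \<open>x\<close> may have infinite order.
\<close>

lemma int_pow_twist_mod:
  fixes u M k :: int
  assumes x: "x \<in> carrier G" and c: "c \<in> carrier G"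
    and up: "c \<otimes> x = x [^] g \<otimes> c" "[g = 1 - u] (mod M)"
    and down: "inv c \<otimes> x = x [^] d \<otimes> inv c" "[d = 1 + u] (mod M)"
    and M: "M dvd u * u"
  shows "\<exists>e. [e = 1 - k * u] (mod M) \<and> c [^] k \<otimes> x = x [^] e \<otimes> c [^] k"
proof (induction k rule: int_induct[where k = 0])
  case base
  show ?case using x by (intro exI[of _ 1]) simp
next
  case (step1 k)
  then obtain e where e: "[e = 1 - k * u] (mod M)" "c [^] k \<otimes> x = x [^] e \<otimes> c [^] k" by blast
  have "c [^] (k + 1) \<otimes> x = c \<otimes> x [^] e \<otimes> c [^] k"
    using x c int_pow_mult[of c 1 k] by (simp add: m_assoc e add.commute)
  also have "\<dots> = x [^] (g * e) \<otimes> c [^] (k + 1)"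
    using x c int_pow_commute_twisted[OF _ _ _ up(1), of e] int_pow_mult[of c 1 k]
    by (simp add: m_assoc int_pow_pow add.commute)
  finally have "c [^] (k + 1) \<otimes> x = x [^] (g * e) \<otimes> c [^] (k + 1)" .
  moreover have "[g * e = 1 - (k + 1) * u] (mod M)"
  proof -
    have "[g * e = (1 - u) * (1 - k * u)] (mod M)" using up(2) e(1) by (rule cong_mult)
    also have "[(1 - u) * (1 - k * u) = 1 - (k + 1) * u] (mod M)"
      using M by (auto simp: cong_iff_dvd_diff algebra_simps)
    finally show ?thesis .
  qed
  ultimately show ?case by blast
next
  case (step2 k)
  then obtain e where e: "[e = 1 - k * u] (mod M)" "c [^] k \<otimes> x = x [^] e \<otimes> c [^] k" by blast
  have p: "c [^] (k - 1) = inv c \<otimes> c [^] k"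
    using c int_pow_mult[of c "-1" k] by (simp add: int_pow_neg)
  have "c [^] (k - 1) \<otimes> x = inv c \<otimes> x [^] e \<otimes> c [^] k"
    using x c p by (simp add: m_assoc e)
  also have "\<dots> = x [^] (d * e) \<otimes> c [^] (k - 1)"
    using x c int_pow_commute_twisted[OF _ _ _ down(1), of e] p
    by (simp add: m_assoc int_pow_pow)
  finally have "c [^] (k - 1) \<otimes> x = x [^] (d * e) \<otimes> c [^] (k - 1)" .
  moreover have "[d * e = 1 - (k - 1) * u] (mod M)"
  proof -
    have "[d * e = (1 + u) * (1 - k * u)] (mod M)" using down(2) e(1) by (rule cong_mult)
    also have "[(1 + u) * (1 - k * u) = 1 - (k - 1) * u] (mod M)"
      using M by (auto simp: cong_iff_dvd_diff algebra_simps)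
    finally show ?thesis .
  qed
  ultimately show ?case by blast
qed

text \<open>
  Collecting the factors \<open>c\<close> of \<open>(x c)\<^sup>n\<close> on the right turns the successive factors \<open>x\<close> into
  \<open>x\<close> to the powers \<open>1, 1 - u, 1 - 2u, \<dots>\<close>, whose sum over \<open>n\<close> terms is \<open>n - u \<phi>(n)\<close>.
\<close>

lemma int_pow_mult_twist_mod:
  fixes u M n :: int
  assumes x: "x \<in> carrier G" and c: "c \<in> carrier G"
    and up: "c \<otimes> x = x [^] g \<otimes> c" "[g = 1 - u] (mod M)"
    and down: "inv c \<otimes> x = x [^] d \<otimes> inv c" "[d = 1 + u] (mod M)"
    and M: "M dvd u * u"
  shows "\<exists>e. [e = n - u * phi n] (mod M) \<and> (x \<otimes> c) [^] n = x [^] e \<otimes> c [^] n"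
proof (induction n rule: int_induct[where k = 0])
  case base
  show ?case using x by (intro exI[of _ 0]) simp
next
  case (step1 n)
  then obtain e where e: "[e = n - u * phi n] (mod M)" "(x \<otimes> c) [^] n = x [^] e \<otimes> c [^] n"
    by blast
  obtain f where f: "[f = 1 - n * u] (mod M)" "c [^] n \<otimes> x = x [^] f \<otimes> c [^] n"
    using int_pow_twist_mod[OF assms] by blast
  have "(x \<otimes> c) [^] (n + 1) = x [^] e \<otimes> (c [^] n \<otimes> x) \<otimes> c"
    using x c by (simp add: int_pow_mult e m_assoc)
  also have "\<dots> = x [^] (e + f) \<otimes> c [^] (n + 1)"
    using x c by (simp add: int_pow_mult f m_assoc)
  finally have "(x \<otimes> c) [^] (n + 1) = x [^] (e + f) \<otimes> c [^] (n + 1)" .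
  moreover have "[e + f = n + 1 - u * phi (n + 1)] (mod M)"
    using cong_add[OF e(1) f(1)] by (simp add: phi_add algebra_simps)
  ultimately show ?case by blast
next
  case (step2 n)
  then obtain e where e: "[e = n - u * phi n] (mod M)" "(x \<otimes> c) [^] n = x [^] e \<otimes> c [^] n"
    by blast
  obtain f where f: "[f = 1 - (n - 1) * u] (mod M)"
      "c [^] (n - 1) \<otimes> x = x [^] f \<otimes> c [^] (n - 1)"
    using int_pow_twist_mod[OF assms] by blast
  have "(x \<otimes> c) [^] (n - 1) \<otimes> (x \<otimes> c) = x [^] (e - f) \<otimes> (x [^] f \<otimes> c [^] (n - 1)) \<otimes> c"
    using x c int_pow_mult[of "x \<otimes> c" "n - 1" 1] int_pow_mult[of x "e - f" f]
      int_pow_mult[of c "n - 1" 1]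
    by (simp add: e m_assoc[symmetric])
  also have "\<dots> = x [^] (e - f) \<otimes> c [^] (n - 1) \<otimes> (x \<otimes> c)"
    using x c by (simp add: f(2)[symmetric] m_assoc)
  finally have "(x \<otimes> c) [^] (n - 1) = x [^] (e - f) \<otimes> c [^] (n - 1)"
    using x c by simp
  moreover have "[e - f = n - 1 - u * phi (n - 1)] (mod M)"
  proof -
    have phi_n: "phi n = phi (n - 1) + (n - 1)"
      using phi_add[of "n - 1" 1] by simp
    show ?thesis
      using cong_diff[OF e(1) f(1)] by (simp add: phi_n algebra_simps)
  qed
  ultimately show ?case by blast
qed

end

section \<open>Consequences of the Macdonald relations\<close>

text \<open>
  The relations are written as rules for exchanging adjacent factors, the form in which
  collection uses them. Exchanging \<open>A\<close> and \<open>B\<close> while inverting \<open>C\<close> preserves them, which halves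
  the work below.
\<close>

locale macdonald = group G for G (structure) +
  fixes A B C :: 'a and u :: int
  assumes A [simp]: "A \<in> carrier G" and B [simp]: "B \<in> carrier G" and C [simp]: "C \<in> carrier G"
    and A_B: "A \<otimes> B = B \<otimes> A \<otimes> C"
    and A_C: "A \<otimes> C = C \<otimes> A [^] (1 + u)"
    and C_B: "C \<otimes> B = B [^] (1 + u) \<otimes> C"
begin

lemma swapped: "macdonald G B A (inv C) u"
proof (unfold_locales)
  show "B \<otimes> A = A \<otimes> B \<otimes> inv C"
    by (simp add: A_B m_assoc)
  show "B \<otimes> inv C = inv C \<otimes> B [^] (1 + u)"
    by (metis A_B B C C_B int_pow_closed inv_closed inv_solve_left' inv_solve_right' m_assoc m_closed)
  show "inv C \<otimes> A = A [^] (1 + u) \<otimes> inv C"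
    by (metis A A_C C int_pow_closed inv_closed inv_solve_left' inv_solve_right' m_assoc m_closed)
qed auto

lemma invC_A: "inv C \<otimes> A = A [^] (1 + u) \<otimes> inv C"
  by (rule macdonald.C_B[OF swapped])

text \<open>
  The relation \<open>A_C\<close> moves \<open>C\<close> past \<open>A\<close> in one direction only. The opposite direction needs
  \<open>1 + u\<close> to be invertible modulo an exponent of \<open>A\<close>.
\<close>

lemma C_A:
  assumes "A [^] P = \<one>" "[(1 + u) * g = 1] (mod P)"
  shows "C \<otimes> A = A [^] g \<otimes> C"
proof -
  have "C \<otimes> (A [^] (1 + u)) [^] g = A [^] g \<otimes> C"
    by (rule int_pow_commute_twisted) (simp_all add: A_C)
  moreover have "(A [^] (1 + u)) [^] g = A"
    using int_pow_eqI[OF A assms] by (simp add: int_pow_pow)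
  ultimately show ?thesis by simp
qed

lemma
  assumes "A [^] P = \<one>" "[(1 + u) * g = 1] (mod P)" "[g = 1 - u] (mod M)" "M dvd u * u"
  shows C_pow_A_mod: "\<exists>e. [e = 1 - k * u] (mod M) \<and> C [^] k \<otimes> A = A [^] e \<otimes> C [^] k"
    and A_pow_B_mod: "\<exists>e. [e = n - u * phi n] (mod M) \<and> A [^] n \<otimes> B = B \<otimes> A [^] e \<otimes> C [^] n"
proof -
  note twist = A C C_A[OF assms(1,2)] assms(3) invC_A cong_refl assms(4)
  show "\<exists>e. [e = 1 - k * u] (mod M) \<and> C [^] k \<otimes> A = A [^] e \<otimes> C [^] k"
    by (rule int_pow_twist_mod[OF twist])
  obtain e where e: "[e = n - u * phi n] (mod M)" "(A \<otimes> C) [^] n = A [^] e \<otimes> C [^] n"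
    using int_pow_mult_twist_mod[OF twist] by blast
  have "B \<otimes> (A \<otimes> C) [^] n = A [^] n \<otimes> B"
    by (rule int_pow_commute_twisted) (simp_all add: A_B m_assoc)
  then show "\<exists>e. [e = n - u * phi n] (mod M) \<and> A [^] n \<otimes> B = B \<otimes> A [^] e \<otimes> C [^] n"
    using e by (auto simp: m_assoc)
qed

text \<open>
  Starting from \<open>C B A\<close>, one can exchange \<open>B\<close> and \<open>A\<close> first, or replace \<open>C B\<close> by
  \<open>B\<^bsup>1+u\<^esup> C\<close> first. Collecting as \<open>A B\<^sup>x A\<^sup>y C\<^sup>-\<^sup>u\<close> gives a pair \<open>x\<close>, \<open>y\<close> for
  each route. The powers of \<open>C\<close> cancel, so a power of \<open>A\<close> equals a power of \<open>B\<close>. The exponent of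
  \<open>A\<close> vanishes to first order in \<open>u\<close>, and what survives is the quadratic term
  \<open>- u \<phi>(- u) = - u\<^sup>2 (u + 1) / 2\<close>.
\<close>

lemma power_A_eq_power_B:
  assumes P: "A [^] P = \<one>" "B [^] P = \<one>" "P dvd u ^ 4" and M: "M dvd u * u"
  shows "\<exists>(f :: int) (h :: int). [f = - u * phi (- u)] (mod M) \<and> A [^] f = B [^] h"
proof -
  \<comment> \<open>Two terms of the product expansion of \<open>1 / (1 + u)\<close>: the error \<open>u\<^sup>4\<close> vanishes modulo \<open>P\<close>.\<close>
  define g where "g = (1 - u) * (1 + u * u)"
  have "(1 + u) * g - 1 = - (u ^ 4)"
    by (simp add: g_def algebra_simps power4_eq_xxxx)
  then have gP: "[(1 + u) * g = 1] (mod P)"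
    using P(3) by (simp add: cong_iff_dvd_diff)
  have gM: "[g = 1 - u] (mod M)"
  proof -
    have "g - (1 - u) = (1 - u) * (u * u)" by (simp add: g_def algebra_simps)
    then show ?thesis using M by (simp add: cong_iff_dvd_diff)
  qed
  note CA = C_A[OF P(1) gP]
  obtain e where e: "[e = - u - u * phi (- u)] (mod M)"
      "A [^] (- u) \<otimes> B = B \<otimes> A [^] e \<otimes> C [^] (- u)"
    using A_pow_B_mod[OF P(1) gP gM M] by blast
  obtain b :: int where b: "B [^] (1 + u) \<otimes> A = A \<otimes> B [^] b \<otimes> inv C [^] (1 + u)"
    using macdonald.A_pow_B_mod[OF swapped P(2) gP gM M, of "1 + u"] by blast
  obtain d where d: "[d = 1 - (- u) * u] (mod M)" "C [^] (- u) \<otimes> A = A [^] d \<otimes> C [^] (- u)"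
    using C_pow_A_mod[OF P(1) gP gM M] by blast
  have C_A': "C \<otimes> A = A \<otimes> C \<otimes> A [^] (- u)"
    using int_pow_mult[OF A, of "1 + u" "- u"] by (simp add: A_C m_assoc)
  \<comment> \<open>First route: exchange \<open>B\<close> and \<open>A\<close>, then \<open>C\<close> and \<open>A\<close>.\<close>
  have "C \<otimes> B \<otimes> A = A \<otimes> C \<otimes> (A [^] (- u) \<otimes> B) \<otimes> inv C"
  proof -
    have "C \<otimes> B \<otimes> A = C \<otimes> A \<otimes> B \<otimes> inv C"
      using macdonald.A_B[OF swapped] by (simp add: m_assoc)
    then show ?thesis by (simp add: C_A' m_assoc)
  qed
  also have "\<dots> = A \<otimes> ((C \<otimes> B) \<otimes> A [^] e \<otimes> C [^] (- u) \<otimes> inv C)"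
    by (simp add: e m_assoc)
  also have "\<dots> = A \<otimes> (B [^] (1 + u) \<otimes> (C \<otimes> A [^] e) \<otimes> C [^] (- u) \<otimes> inv C)"
    by (simp add: C_B m_assoc)
  also have "C \<otimes> A [^] e = A [^] (g * e) \<otimes> C"
    using int_pow_commute_twisted[OF _ _ _ CA, of e] by (simp add: int_pow_pow)
  also have "A \<otimes> (B [^] (1 + u) \<otimes> (A [^] (g * e) \<otimes> C) \<otimes> C [^] (- u) \<otimes> inv C)
      = A \<otimes> (B [^] (1 + u) \<otimes> A [^] (g * e) \<otimes> C [^] (- u))"
  proof -
    have "C \<otimes> (C [^] (- u) \<otimes> inv C) = C [^] (- u)"
      using int_pow_mult[OF C, of "- u" "- 1"] int_pow_mult[OF C, of 1 "- u - 1"]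
      by (simp add: int_pow_neg[of C 1])
    then show ?thesis by (simp add: m_assoc)
  qed
  finally have 1: "C \<otimes> B \<otimes> A = A \<otimes> (B [^] (1 + u) \<otimes> A [^] (g * e) \<otimes> C [^] (- u))" .
  \<comment> \<open>Second route: rewrite \<open>C B\<close>, then move \<open>A\<close> past \<open>B\<^bsup>1+u\<^esup>\<close>.\<close>
  have "C \<otimes> B \<otimes> A = B [^] (1 + u) \<otimes> A \<otimes> C \<otimes> A [^] (- u)"
    by (simp add: C_B C_A' m_assoc)
  also have "\<dots> = A \<otimes> (B [^] b \<otimes> (inv C [^] (1 + u) \<otimes> C \<otimes> A [^] (- u)))"
    by (simp add: b m_assoc)
  also have "inv C [^] (1 + u) \<otimes> C = C [^] (- u)"
    using int_pow_mult[OF C, of "- (1 + u)" 1] by (simp add: int_pow_inv int_pow_neg[of C "1 + u", symmetric])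
  also have "C [^] (- u) \<otimes> A [^] (- u) = A [^] (d * (- u)) \<otimes> C [^] (- u)"
    using int_pow_commute_twisted[OF _ _ _ d(2), of "- u"] by (simp add: int_pow_pow)
  finally have 2: "C \<otimes> B \<otimes> A = A \<otimes> (B [^] b \<otimes> (A [^] (d * (- u)) \<otimes> C [^] (- u)))" .
  have "B [^] (1 + u) \<otimes> A [^] (g * e) = B [^] b \<otimes> A [^] (d * (- u))"
    using 1 2 by (simp add: m_assoc[symmetric]) (simp add: m_assoc)
  then have "A [^] (g * e - d * (- u)) = B [^] (b - (1 + u))"
  proof -
    assume *: "B [^] (1 + u) \<otimes> A [^] (g * e) = B [^] b \<otimes> A [^] (d * (- u))"
    have "B [^] (1 + u) \<otimes> A [^] (g * e - d * (- u)) \<otimes> A [^] (d * (- u)) = B [^] b \<otimes> A [^] (d * (- u))"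
      using * int_pow_mult[OF A, of "g * e - d * (- u)" "d * (- u)"] by (simp add: m_assoc)
    then have "B [^] (1 + u) \<otimes> A [^] (g * e - d * (- u)) = B [^] b"
      by (subst (asm) right_cancel) auto
    also have "\<dots> = B [^] (1 + u) \<otimes> B [^] (b - (1 + u))"
      using int_pow_mult[OF B, of "1 + u" "b - (1 + u)"] by simp
    finally show ?thesis by (subst (asm) Units_l_cancel) (auto simp: Units_eq)
  qed
  moreover have "[g * e - d * (- u) = - u * phi (- u)] (mod M)"
  proof -
    have "[g * e - d * (- u) = (1 - u) * (- u - u * phi (- u)) - (1 - (- u) * u) * (- u)] (mod M)"
      by (intro cong_diff cong_mult gM e(1) d(1) cong_refl)
    also have "(1 - u) * (- u - u * phi (- u)) - (1 - (- u) * u) * (- u)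
        = - u * phi (- u) + (u * u) * (1 + phi (- u) + u)"
      by (simp add: algebra_simps)
    also have "[\<dots> = - u * phi (- u) + 0] (mod M)"
      using M by (intro cong_add cong_refl) (simp add: cong_0_iff)
    finally show ?thesis by simp
  qed
  ultimately show ?thesis by blast
qed

text \<open>
  The power of \<open>A\<close> that is a power of \<open>B\<close> has exponent \<open>- u\<^sup>2 (u + 1) / 2\<close> modulo \<open>2\<^bsup>2m\<^esup>\<close>.
  As \<open>l\<close> and \<open>u + 1\<close> are odd, this is an odd multiple of \<open>2\<^bsup>2m-1\<^esup>\<close>, and the odd factor is
  invertible modulo \<open>2\<^bsup>3m-1\<^esup>\<close>, the exponent that kills \<open>A\<close>.
\<close>

lemma A_pow_commute_B:
  fixes l :: int
  assumes m: "m \<ge> 1" and l: "odd l" and u: "u = 2 ^ m * l"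
    and P: "A [^] (2 ^ (3 * m - 1) :: int) = \<one>" "B [^] (2 ^ (3 * m - 1) :: int) = \<one>"
  shows "A [^] (2 ^ (2 * m - 1) :: int) \<otimes> B = B \<otimes> A [^] (2 ^ (2 * m - 1) :: int)"
proof -
  define N :: int where "N = 2 ^ (2 * m - 1)"
  have N2: "(2::int) ^ (2 * m) = 2 * N" and NP: "(2::int) ^ (3 * m - 1) = N * 2 ^ m"
    using m by (simp_all add: N_def power_Suc[symmetric] power_add[symmetric] del: power_Suc)
  have uu: "u * u = 2 * N * (l * l)"
    unfolding N2[symmetric] by (simp add: u mult_2 power_add)
  have "(2::int) ^ (3 * m - 1) dvd u ^ 4"
  proof -
    have "(2::int) ^ (3 * m - 1) dvd 2 ^ (m * 4)" by (rule le_imp_power_dvd) simp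
    then show ?thesis by (simp add: u power_mult_distrib power_mult[symmetric])
  qed
  from power_A_eq_power_B[OF P this, of "2 * N"] uu
  obtain f h :: int where f: "[f = - u * phi (- u)] (mod (2 * N))" and Af: "A [^] f = B [^] h" by auto
  have "2 * (- u * phi (- u)) = 2 * (N * (l * l * (- u - 1)))"
    using phi_double[of "- u"] uu by algebra
  then have "- u * phi (- u) = N * (l * l * (- u - 1))" by simp
  with f obtain t where f_t: "f = N * (l * l * (- u - 1)) + 2 * N * t"
    by (metis cong_iff_lin cong_sym mult.commute)
  define r where "r = l * l * (- u - 1) + 2 * t"
  have f_eq: "f = N * r" unfolding r_def f_t by (simp add: algebra_simps)
  have "even u" using m u by simp
  then have "coprime r (2 ^ m)"
    using l by (simp add: r_def coprime_right_2_iff_odd)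
  then obtain p q where pq: "p * r + q * 2 ^ m = 1"
    by (metis bezout_int coprime_iff_gcd_eq_1)
  have "N = N * (p * r + q * 2 ^ m)" by (simp add: pq)
  then have N_eq: "N = f * p + 2 ^ (3 * m - 1) * q"
    unfolding f_eq NP by (simp only: algebra_simps)
  have "A [^] N = (A [^] f) [^] p"
    unfolding N_eq using P by (simp add: int_pow_mult int_pow_pow[symmetric])
  also have "\<dots> = B [^] (h * p)"
    by (simp add: Af int_pow_pow)
  finally have "A [^] N = B [^] (h * p)" .
  then show ?thesis
    unfolding N_def[symmetric]
    using int_pow_mult[OF B, of "h * p" 1] int_pow_mult[OF B, of 1 "h * p"] by (simp add: add.commute)
qed

text \<open>
  Conjugation by \<open>C\<close> raises \<open>A\<close> to the power \<open>1 + u\<close>, and \<open>1 + u\<close> has order dividing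
  \<open>2\<^bsup>2m-1\<^esup>\<close> modulo \<open>2\<^bsup>3m-1\<^esup>\<close>, because the square of a number that is \<open>1\<close>
  modulo an even \<open>q\<close> is \<open>1\<close> modulo \<open>2q\<close>.
\<close>

lemma C_pow_commute_A:
  fixes l :: int
  assumes m: "m \<ge> 1" and u: "u = 2 ^ m * l" and P: "A [^] (2 ^ (3 * m - 1) :: int) = \<one>"
  shows "C [^] (2 ^ (2 * m - 1) :: int) \<otimes> A = A \<otimes> C [^] (2 ^ (2 * m - 1) :: int)"
proof -
  have tw: "inv C [^] n \<otimes> A = A [^] ((1 + u) ^ n) \<otimes> inv C [^] n" for n :: nat
  proof (induction n)
    case (Suc n)
    have "inv C [^] Suc n \<otimes> A = inv C [^] n \<otimes> A [^] (1 + u) \<otimes> inv C"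
      by (simp add: m_assoc invC_A)
    also have "\<dots> = A [^] ((1 + u) ^ Suc n) \<otimes> inv C [^] Suc n"
      using int_pow_commute_twisted[OF _ _ _ Suc, of "1 + u"]
      by (simp add: m_assoc int_pow_pow mult.commute)
    finally show ?case .
  qed simp
  have 2: "[(1 + u) ^ (2 ^ n) = 1] (mod 2 ^ (m + n))" for n
  proof (induction n)
    case 0 then show ?case by (simp add: u cong_iff_dvd_diff)
  next
    case (Suc n)
    then obtain t where t: "(1 + u) ^ (2 ^ n) = 1 + 2 ^ (m + n) * t"
      by (metis cong_iff_lin cong_sym)
    have "(1 + u) ^ (2 ^ Suc n) = ((1 + u) ^ (2 ^ n))\<^sup>2"
      by (simp add: power_mult[symmetric] mult.commute)
    also have "\<dots> = 1 + 2 * 2 ^ (m + n) * (t + 2 ^ (m + n - 1) * t * t)"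
    proof -
      have "(2::int) ^ (m + n) = 2 * 2 ^ (m + n - 1)"
        using m by (simp add: power_Suc[symmetric] del: power_Suc)
      then have "2 ^ (m + n) * (2 ^ (m + n) * t * t) = 2 * 2 ^ (m + n) * (2 ^ (m + n - 1) * t * t)"
        by simp
      then show ?thesis unfolding t by (simp add: power2_eq_square algebra_simps)
    qed
    finally show ?case by (simp add: cong_iff_dvd_diff)
  qed
  have "inv C [^] (2 ^ (2 * m - 1) :: nat) \<otimes> A = A \<otimes> inv C [^] (2 ^ (2 * m - 1) :: nat)"
  proof -
    have "m + (2 * m - 1) = 3 * m - 1" using m by simp
    then have "A [^] ((1 + u) ^ (2 ^ (2 * m - 1))) = A [^] (1::int)"
      using int_pow_eqI[OF A P] 2[of "2 * m - 1"] by simp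
    then show ?thesis using tw[of "2 ^ (2 * m - 1)"] by simp
  qed
  moreover have "inv C [^] (2 ^ (2 * m - 1) :: nat) = inv (C [^] (2 ^ (2 * m - 1) :: int))"
    using int_pow_int[of G C "2 ^ (2 * m - 1)"] by (simp add: nat_pow_inv)
  ultimately show ?thesis
    using inv_commute[of "inv (C [^] (2 ^ (2 * m - 1) :: int))" A] by simp
qed

end

section \<open>Multiplication modulo the center\<close>

text \<open>
  The situation in the quotient by the center. With \<open>u = 2v\<close>, the exponent \<open>2v\<^sup>2 = u\<^sup>2/2\<close> is the
  largest one for which both \<open>u\<^sup>2\<close> and all \<open>u \<phi>(u x) = u\<^sup>2 x (u x - 1) / 2\<close> are zero as exponents.
\<close>

locale macdonald_mod_center = macdonald G A B C "2 * v" for G (structure) and A B C and v :: int +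
  assumes A_exponent: "A [^] (2 * (v * v)) = \<one>"
    and B_exponent: "B [^] (2 * (v * v)) = \<one>"
    and C_exponent: "C [^] (2 * (v * v)) = \<one>"
begin

abbreviation u :: int where "u \<equiv> 2 * v"

lemma swapped_mod_center: "macdonald_mod_center G B A (inv C) v"
  using swapped A_exponent B_exponent C_exponent
  by (simp add: macdonald_mod_center_def macdonald_mod_center_axioms_def int_pow_inv)

text \<open>In the applications, \<open>2 v\<^sup>2 t\<close> consists of the discarded terms quadratic in \<open>u\<close>.\<close>

lemma int_pow_cong:
  assumes "x \<in> {A, B, C}" "e = f + 2 * (v * v) * t"
  shows "x [^] e = x [^] f"
  using assms A_exponent B_exponent C_exponent
  by (auto intro!: int_pow_eqI[where M = "2 * (v * v)"] simp: cong_iff_dvd_diff)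

lemma C_pow_A_pow: "C [^] k \<otimes> A [^] n = A [^] (n - u * k * n) \<otimes> C [^] k"
  and A_pow_B: "A [^] n \<otimes> B = B \<otimes> A [^] (n - u * phi n) \<otimes> C [^] n"
proof -
  have 1: "[(1 + u) * (1 - u) = 1] (mod 2 * (v * v))"
    by (simp add: cong_iff_dvd_diff algebra_simps)
  note * = A_exponent 1 cong_refl
  have M: "2 * (v * v) dvd u * u" by simp
  obtain e where e: "[e = 1 - k * u] (mod 2 * (v * v))" "C [^] k \<otimes> A = A [^] e \<otimes> C [^] k"
    using C_pow_A_mod[OF * M] by blast
  have "C [^] k \<otimes> A = A [^] (1 - k * u) \<otimes> C [^] k"
    unfolding e(2) using int_pow_eqI[OF A A_exponent e(1)] by simp
  from int_pow_commute_twisted[OF _ _ _ this, of n]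
  show "C [^] k \<otimes> A [^] n = A [^] (n - u * k * n) \<otimes> C [^] k"
    by (simp add: int_pow_pow algebra_simps)
  obtain e where e: "[e = n - u * phi n] (mod 2 * (v * v))" "A [^] n \<otimes> B = B \<otimes> A [^] e \<otimes> C [^] n"
    using A_pow_B_mod[OF * M] by blast
  then show "A [^] n \<otimes> B = B \<otimes> A [^] (n - u * phi n) \<otimes> C [^] n"
    using int_pow_eqI[OF A A_exponent e(1)] by simp
qed

lemma C_pow_B_pow: "C [^] k \<otimes> B [^] n = B [^] (n + u * k * n) \<otimes> C [^] k"
  using macdonald_mod_center.C_pow_A_pow[OF swapped_mod_center, of "- k" n]
  by (simp add: int_pow_inv int_pow_neg)

lemma B_pow_A: "B [^] n \<otimes> A = A \<otimes> B [^] (n - u * phi n) \<otimes> C [^] (- n)"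
  using macdonald_mod_center.A_pow_B[OF swapped_mod_center, of n]
  by (simp add: int_pow_inv int_pow_neg)

text \<open>In an exponent with a factor \<open>u\<close>, the argument of \<open>\<phi>\<close> matters only modulo \<open>u\<close>.\<close>

lemma u_phi: "u * phi (n + u * x) = u * phi n + 2 * (v * v) * (x * (u * x + 2 * n - 1))"
  using phi_double[of "n + u * x"] phi_double[of n] by algebra

text \<open>
  Commuting with a power whose exponent is divisible by \<open>u\<close> costs terms quadratic in \<open>u\<close>, which
  vanish. Thus \<open>C\<^sup>u\<close> commutes with \<open>A\<close> and \<open>B\<close>, and \<open>A\<^sup>u\<close> commutes with \<open>C\<close>. The exception is
  the pair \<open>A\<^sup>u\<close>, \<open>B\<close>, whose commutator \<open>C\<^sup>u\<close> is linear in \<open>u\<close>.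
\<close>

lemma A_upow_commute:
  fixes k n x :: int
  shows "C [^] k \<otimes> A [^] (u * x) = A [^] (u * x) \<otimes> C [^] k"
    and "B [^] n \<otimes> A [^] (u * x) = A [^] (u * x) \<otimes> B [^] n \<otimes> C [^] (- (u * n * x))"
proof -
  have "A [^] (u * x - u * k * (u * x)) = A [^] (u * x)" for k :: int
    by (rule int_pow_cong[where t = "- 2 * k * x"]) simp_all
  then have C_A_upow: "C [^] k \<otimes> A [^] (u * x) = A [^] (u * x) \<otimes> C [^] k" for k :: int
    using C_pow_A_pow[of k "u * x"] by simp
  then show "C [^] k \<otimes> A [^] (u * x) = A [^] (u * x) \<otimes> C [^] k" .
  have "A [^] (1 - u * (u * x) * 1) = A [^] (1 :: int)"
    by (rule int_pow_cong[where t = "- 2 * x"]) simp_all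
  then have CA: "C [^] (u * x) \<otimes> A = A \<otimes> C [^] (u * x)"
    using C_pow_A_pow[of "u * x" 1] by simp
  have "B [^] (1 + u * (u * x) * 1) = B [^] (1 :: int)"
    by (rule int_pow_cong[where t = "2 * x"]) simp_all
  then have CB: "C [^] (u * x) \<otimes> B = B \<otimes> C [^] (u * x)"
    using C_pow_B_pow[of "u * x" 1] by simp
  have "A [^] (u * x - u * phi (u * x)) = A [^] (u * x)"
    by (rule int_pow_cong[where t = "- x * (u * x - 1)"]) (use u_phi[of 0 x] in simp_all)
  then have "A [^] (u * x) \<otimes> B = B \<otimes> (A [^] (u * x) \<otimes> C [^] (u * x))"
    using A_pow_B[of "u * x"] by (simp add: m_assoc)
  also have "A [^] (u * x) \<otimes> C [^] (u * x) = C [^] (u * x) \<otimes> A [^] (u * x)"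
    using int_pow_commute_twisted[OF _ _ _ CA] by simp
  finally have AB: "A [^] (u * x) \<otimes> B = (B \<otimes> C [^] (u * x)) \<otimes> A [^] (u * x)"
    by (simp add: m_assoc)
  have "A [^] (u * x) \<otimes> B [^] n = (B \<otimes> C [^] (u * x)) [^] n \<otimes> A [^] (u * x)"
    by (rule int_pow_commute_twisted[OF _ _ _ AB]) simp_all
  also have "(B \<otimes> C [^] (u * x)) [^] n = B [^] n \<otimes> C [^] (u * n * x)"
    using CB by (simp add: int_pow_mult_distrib int_pow_pow ac_simps)
  finally have "A [^] (u * x) \<otimes> B [^] n = B [^] n \<otimes> (C [^] (u * n * x) \<otimes> A [^] (u * x))"
    by (simp add: m_assoc)
  also have "C [^] (u * n * x) \<otimes> A [^] (u * x) = A [^] (u * x) \<otimes> C [^] (u * n * x)"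
    by (rule C_A_upow)
  finally show "B [^] n \<otimes> A [^] (u * x) = A [^] (u * x) \<otimes> B [^] n \<otimes> C [^] (- (u * n * x))"
    using int_pow_mult[OF C, of "u * n * x" "- (u * n * x)"] by (simp add: m_assoc)
qed

text \<open>
  The heart of the collection process, by induction on \<open>a\<close>. One further factor \<open>A\<close> is moved left
  past the power of \<open>C\<close>, which leaves \<open>A\<^bsup>u j a\<^esup>\<close> behind, and past the power of \<open>B\<close>, which leaves
  \<open>B\<^bsup>- u \<phi>(j)\<^esup>\<close> and \<open>C\<^sup>-\<^sup>j\<close> behind; the element \<open>A\<^bsup>u j a\<^esup>\<close> is then moved left in turn. Summing
  \<open>u j a\<close> over the steps produces \<open>u j \<phi>(a)\<close>.
\<close>

lemma B_pow_A_pow: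
  "B [^] j \<otimes> A [^] a =
     A [^] (a + u * (j * phi a)) \<otimes> B [^] (j - u * (a * phi j)) \<otimes>
     C [^] (u * (phi j * phi a - j * j * phi a) - j * a)"
  (is "_ = ?R a")
proof -
  have step: "?R a \<otimes> A = ?R (a + 1)" for a
  proof -
    \<comment> \<open>The exponents of \<open>B\<close> and \<open>C\<close> before the step, and that of \<open>B\<close> after it.\<close>
    define J z where "J = j - u * (a * phi j)" and "z = u * (phi j * phi a - j * j * phi a) - j * a"
    define J' where "J' = j - u * ((a + 1) * phi j)"
    have "A [^] (1 - u * z * 1) = A [^] (1 + u * (j * a))"
      by (rule int_pow_cong[where t = "- 2 * (phi j * phi a - j * j * phi a)"])
        (simp_all add: z_def algebra_simps)
    then have "C [^] z \<otimes> A = A \<otimes> A [^] (u * (j * a)) \<otimes> C [^] z"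
      using C_pow_A_pow[of z 1] by (simp add: int_pow_mult)
    then have "?R a \<otimes> A = A [^] (a + u * (j * phi a)) \<otimes>
        ((B [^] J \<otimes> A) \<otimes> A [^] (u * (j * a)) \<otimes> C [^] z)"
      unfolding J_def[symmetric] z_def[symmetric] by (simp add: m_assoc)
    also have "B [^] J \<otimes> A = A \<otimes> B [^] J' \<otimes> C [^] (- J)"
    proof -
      have "u * phi J = u * phi j + 2 * (v * v) * (- (a * phi j) * (u * - (a * phi j) + 2 * j - 1))"
        using u_phi[of j "- (a * phi j)"] by (simp add: J_def)
      then have "B [^] (J - u * phi J) = B [^] J'"
        by (intro int_pow_cong[where t = "(a * phi j) * (u * - (a * phi j) + 2 * j - 1)"])
          (simp_all add: J_def J'_def algebra_simps)
      then show ?thesis using B_pow_A[of J] by simp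
    qed
    also have "A [^] (a + u * (j * phi a)) \<otimes> ((A \<otimes> B [^] J' \<otimes> C [^] (- J)) \<otimes> A [^] (u * (j * a)) \<otimes> C [^] z)
      = A [^] (a + u * (j * phi a) + 1) \<otimes> (B [^] J' \<otimes> (C [^] (- J) \<otimes> A [^] (u * (j * a))) \<otimes> C [^] z)"
      by (simp add: int_pow_mult m_assoc)
    also have "C [^] (- J) \<otimes> A [^] (u * (j * a)) = A [^] (u * (j * a)) \<otimes> C [^] (- J)"
      by (rule A_upow_commute)
    also have "B [^] J' \<otimes> (A [^] (u * (j * a)) \<otimes> C [^] (- J)) \<otimes> C [^] z
      = A [^] (u * (j * a)) \<otimes> (B [^] J' \<otimes> C [^] (- (u * J' * (j * a)) + - J + z))"
    proof -
      have "B [^] J' \<otimes> (A [^] (u * (j * a)) \<otimes> C [^] (- J)) \<otimes> C [^] z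
        = (B [^] J' \<otimes> A [^] (u * (j * a))) \<otimes> C [^] (- J) \<otimes> C [^] z"
        by (simp add: m_assoc)
      then show ?thesis
        unfolding A_upow_commute(2) by (simp only: int_pow_mult m_assoc A B C int_pow_closed m_closed)
    qed
    also have "C [^] (- (u * J' * (j * a)) + - J + z) =
        C [^] (u * (phi j * phi (a + 1) - j * j * phi (a + 1)) - j * (a + 1))"
      by (rule int_pow_cong[where t = "2 * (a + 1) * phi j * j * a"])
        (simp_all add: J_def J'_def z_def phi_add algebra_simps)
    finally show ?thesis
      by (simp add: J'_def phi_add m_assoc[symmetric] int_pow_mult[symmetric] algebra_simps)
  qed
  show ?thesis
  proof (induction a rule: int_induct[where k = 0])
    case base
    show ?case by simp
  next
    case (step1 a)
    show ?case using step[of a] by (simp add: int_pow_mult m_assoc[symmetric] step1)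
  next
    case (step2 a)
    have "B [^] j \<otimes> A [^] (a - 1) \<otimes> A = ?R (a - 1) \<otimes> A"
      using step[of "a - 1"] step2 int_pow_mult[of A "a - 1" 1] by (simp add: m_assoc)
    then show ?case by (subst (asm) right_cancel) simp_all
  qed
qed

text \<open>
  Since terms quadratic in \<open>u\<close> vanish, the three exchanges contribute independently: \<open>C\<^sup>k\<close> with
  \<open>A\<^sup>a\<close>, then \<open>B\<^sup>j\<close> with \<open>A\<^sup>a\<close>, and finally \<open>B\<^sup>b\<close> with the power of \<open>C\<close> collected so far, which
  is \<open>C\<^bsup>k - j a\<^esup>\<close> to first order.
\<close>

lemma normal_form_mult:
  "(A [^] i \<otimes> B [^] j \<otimes> C [^] k) \<otimes> (A [^] a \<otimes> B [^] b \<otimes> C [^] c) =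
     A [^] (i + a + u * (j * phi a - k * a)) \<otimes>
     B [^] (j + b + u * (k * b - a * phi j - j * a * b)) \<otimes>
     C [^] (k + c - j * a + u * (j * k * a + phi j * phi a - j * j * phi a))"
proof -
  \<comment> \<open>The exponents that arise when \<open>A\<^sup>a\<close> passes \<open>C\<^sup>k\<close> and then \<open>B\<^sup>j\<close>; \<open>y\<close> collects the error
    of replacing \<open>a'\<close> by \<open>a\<close> under \<open>\<phi>\<close>.\<close>
  define a' where "a' = a - u * k * a"
  define z where "z = u * (phi j * phi a' - j * j * phi a') - j * a'"
  define y where "y = - (k * a) * (u * - (k * a) + 2 * a - 1)"
  have phi_a': "u * phi a' = u * phi a + 2 * (v * v) * y"
    using u_phi[of a "- (k * a)"] by (simp add: a'_def y_def mult.assoc)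
  have "(A [^] i \<otimes> B [^] j \<otimes> C [^] k) \<otimes> (A [^] a \<otimes> B [^] b \<otimes> C [^] c)
      = A [^] i \<otimes> (B [^] j \<otimes> (C [^] k \<otimes> A [^] a) \<otimes> B [^] b \<otimes> C [^] c)"
    by (simp add: m_assoc)
  also have "\<dots> = A [^] i \<otimes> ((B [^] j \<otimes> A [^] a') \<otimes> C [^] k \<otimes> B [^] b \<otimes> C [^] c)"
    by (simp add: C_pow_A_pow a'_def m_assoc)
  also have "B [^] j \<otimes> A [^] a' =
      A [^] (a' + u * (j * phi a')) \<otimes> B [^] (j - u * (a' * phi j)) \<otimes> C [^] z"
    unfolding z_def by (rule B_pow_A_pow)
  also have "A [^] i \<otimes> (A [^] (a' + u * (j * phi a')) \<otimes> B [^] (j - u * (a' * phi j)) \<otimes> C [^] z \<otimes>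
        C [^] k \<otimes> B [^] b \<otimes> C [^] c)
      = A [^] (i + (a' + u * (j * phi a'))) \<otimes>
        (B [^] (j - u * (a' * phi j)) \<otimes> (C [^] (z + k) \<otimes> B [^] b) \<otimes> C [^] c)"
    by (simp only: int_pow_mult m_assoc A B C int_pow_closed m_closed)
  also have "\<dots> = A [^] (i + (a' + u * (j * phi a'))) \<otimes>
        (B [^] (j - u * (a' * phi j) + (b + u * (z + k) * b)) \<otimes> C [^] (z + k + c))"
    unfolding C_pow_B_pow by (simp only: int_pow_mult m_assoc A B C int_pow_closed m_closed)
  also have "A [^] (i + (a' + u * (j * phi a'))) = A [^] (i + a + u * (j * phi a - k * a))"
  proof (rule int_pow_cong)
    show "i + (a' + u * (j * phi a')) = i + a + u * (j * phi a - k * a) + 2 * (v * v) * (j * y)"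
      unfolding a'_def[symmetric] using phi_a' a'_def by algebra
  qed simp
  also have "B [^] (j - u * (a' * phi j) + (b + u * (z + k) * b)) =
      B [^] (j + b + u * (k * b - a * phi j - j * a * b))"
  proof (rule int_pow_cong)
    show "j - u * (a' * phi j) + (b + u * (z + k) * b) = j + b + u * (k * b - a * phi j - j * a * b)
        + 2 * (v * v) * (2 * k * a * phi j + 2 * b * (phi j * phi a' - j * j * phi a' + j * k * a))"
      using z_def a'_def by algebra
  qed simp
  also have "C [^] (z + k + c) =
      C [^] (k + c - j * a + u * (j * k * a + phi j * phi a - j * j * phi a))"
  proof (rule int_pow_cong)
    show "z + k + c = k + c - j * a + u * (j * k * a + phi j * phi a - j * j * phi a)
        + 2 * (v * v) * (y * (phi j - j * j))"
      using z_def a'_def phi_a' by algebra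
  qed simp
  finally show ?thesis by (simp add: m_assoc)
qed

text \<open>
  The commutator of \<open>x\<close> and \<open>y\<close> is the unique \<open>w\<close> with \<open>x y = y x w\<close>, so it suffices to compare
  normal forms of both sides. The factor \<open>w\<close> has exponents \<open>u E\<close> and \<open>u F\<close> at \<open>A\<close> and \<open>B\<close>, so
  multiplication by it adds exponents up to the single correction \<open>- (j + b) u E\<close> at \<open>C\<close>.
\<close>

lemma commutator_normal_form:
  fixes i j k a b c :: int
  defines "eA \<equiv> u * (j * phi a - phi i * b + i * c - k * a)"
    and "eB \<equiv> u * (i * phi b - phi j * a + k * b + j * (i * b - a * b - c))"
    and "eC \<equiv> i * b - j * a + u * (phi a * (phi j + j * b) - phi i * (phi b + j * b)
                             + i * j * c - k * a * b)"
  shows "commutator G (A [^] i \<otimes> B [^] j \<otimes> C [^] k) (A [^] a \<otimes> B [^] b \<otimes> C [^] c) =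
    A [^] eA \<otimes> B [^] eB \<otimes> C [^] eC"
proof -
  define x y w where "x = A [^] i \<otimes> B [^] j \<otimes> C [^] k" and "y = A [^] a \<otimes> B [^] b \<otimes> C [^] c"
    and "w = A [^] eA \<otimes> B [^] eB \<otimes> C [^] eC"
  have closed: "x \<in> carrier G" "y \<in> carrier G" "w \<in> carrier G"
    by (simp_all add: x_def y_def w_def)
  define E F where "E = j * phi a - phi i * b + i * c - k * a"
    and "F = i * phi b - phi j * a + k * b + j * (i * b - a * b - c)"
  \<comment> \<open>The exponents of the normal form of \<open>y x\<close>.\<close>
  define p q r where "p = a + i + u * (b * phi i - c * i)"
    and "q = b + j + u * (c * j - i * phi b - b * i * j)"
    and "r = c + k - b * i + u * (b * c * i + phi b * phi i - b * b * phi i)"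
  have eA: "eA = u * E" and eB: "eB = u * F"
    by (simp_all add: eA_def eB_def E_def F_def)
  have phi_eA: "u * phi eA = 2 * (v * v) * (E * (u * E - 1))"
    using u_phi[of 0 E] by (simp add: eA)
  have "(y \<otimes> x) \<otimes> w = (A [^] p \<otimes> B [^] q \<otimes> C [^] r) \<otimes> (A [^] eA \<otimes> B [^] eB \<otimes> C [^] eC)"
    unfolding x_def y_def w_def normal_form_mult p_def q_def r_def ..
  also have "\<dots> = A [^] (p + eA + u * (q * phi eA - r * eA)) \<otimes>
     B [^] (q + eB + u * (r * eB - eA * phi q - q * eA * eB)) \<otimes>
     C [^] (r + eC - q * eA + u * (q * r * eA + phi q * phi eA - q * q * phi eA))"
    by (rule normal_form_mult)
  also have "A [^] (p + eA + u * (q * phi eA - r * eA)) = A [^] (i + a + u * (j * phi a - k * a))"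
  proof (rule int_pow_cong)
    show "p + eA + u * (q * phi eA - r * eA) = i + a + u * (j * phi a - k * a)
        + 2 * (v * v) * (q * E * (u * E - 1) - 2 * r * E)"
      using phi_eA eA p_def E_def by algebra
  qed simp
  also have "B [^] (q + eB + u * (r * eB - eA * phi q - q * eA * eB)) =
      B [^] (j + b + u * (k * b - a * phi j - j * a * b))"
  proof (rule int_pow_cong)
    show "q + eB + u * (r * eB - eA * phi q - q * eA * eB)
        = j + b + u * (k * b - a * phi j - j * a * b)
        + 2 * (v * v) * (2 * r * F - 2 * E * phi q - 2 * q * E * u * F)"
    proof -
      have "q + eB = j + b + u * (k * b - a * phi j - j * a * b)"
        using eB q_def F_def by algebra
      then show ?thesis using eA eB by algebra
    qed
  qed simp
  also have "C [^] (r + eC - q * eA + u * (q * r * eA + phi q * phi eA - q * q * phi eA)) =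
      C [^] (k + c - j * a + u * (j * k * a + phi j * phi a - j * j * phi a))"
  proof (rule int_pow_cong)
    have "r + eC - (b + j) * eA = k + c - j * a + u * (j * k * a + phi j * phi a - j * j * phi a)"
      using eA r_def E_def eC_def by algebra
    then show "r + eC - q * eA + u * (q * r * eA + phi q * phi eA - q * q * phi eA)
        = k + c - j * a + u * (j * k * a + phi j * phi a - j * j * phi a)
        + 2 * (v * v) * (2 * q * r * E - 2 * (c * j - i * phi b - b * i * j) * E
            + E * (u * E - 1) * (phi q - q * q))"
      using eA q_def phi_eA by algebra
  qed simp
  also have "A [^] (i + a + u * (j * phi a - k * a)) \<otimes>
      B [^] (j + b + u * (k * b - a * phi j - j * a * b)) \<otimes>
      C [^] (k + c - j * a + u * (j * k * a + phi j * phi a - j * j * phi a)) = x \<otimes> y"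
    unfolding x_def y_def by (rule normal_form_mult[symmetric])
  finally have "x \<otimes> y = y \<otimes> (x \<otimes> w)"
    using closed by (simp add: m_assoc)
  then have "inv x \<otimes> (inv y \<otimes> (x \<otimes> y)) = inv x \<otimes> (inv y \<otimes> (y \<otimes> (x \<otimes> w)))"
    by simp
  also have "\<dots> = w"
    using closed by (simp add: m_assoc[symmetric])
  finally show ?thesis
    using closed unfolding commutator_def x_def[symmetric] y_def[symmetric] w_def[symmetric]
    by (simp add: m_assoc)
qed

end

section \<open>Commutators, centers and presentations\<close>

lemma (in group) commutator_closed [simp]:
  "x \<in> carrier G \<Longrightarrow> y \<in> carrier G \<Longrightarrow> commutator G x y \<in> carrier G"
  by (simp add: commutator_def)

lemma (in group) mult_commutator:
  "x \<in> carrier G \<Longrightarrow> y \<in> carrier G \<Longrightarrow> x \<otimes> y = y \<otimes> x \<otimes> commutator G x y"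
proof -
  assume x: "x \<in> carrier G" and y: "y \<in> carrier G"
  then have "commutator G x y = inv (y \<otimes> x) \<otimes> (x \<otimes> y)"
    by (simp add: commutator_def inv_mult_group m_assoc)
  then show ?thesis
    using x y m_assoc[of "y \<otimes> x" "inv (y \<otimes> x)" "x \<otimes> y"] by simp
qed

lemma (in group) inv_commutator:
  "x \<in> carrier G \<Longrightarrow> y \<in> carrier G \<Longrightarrow> inv (commutator G x y) = commutator G y x"
  by (simp add: commutator_def inv_mult_group m_assoc)

lemma (in group_hom) hom_commutator:
  "x \<in> carrier G \<Longrightarrow> y \<in> carrier G \<Longrightarrow> h (commutator G x y) = commutator H (h x) (h y)"
  by (simp add: commutator_def)

lemma (in group_hom) hom_conjugate:
  "x \<in> carrier G \<Longrightarrow> y \<in> carrier G \<Longrightarrow> h (conjugate G x y) = conjugate H (h x) (h y)"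
  by (simp add: conjugate_def)

lemma (in group) macdonaldI:
  assumes AB: "A \<in> carrier G" "B \<in> carrier G"
    and A: "conjugate G A (commutator G A B) = A [^] (1 + u :: int)"
    and B: "conjugate G B (commutator G B A) = B [^] (1 + u)"
  shows "macdonald G A B (commutator G A B) u"
proof
  let ?C = "commutator G A B"
  show "A \<otimes> B = B \<otimes> A \<otimes> ?C" by (rule mult_commutator[OF AB])
  have "A \<otimes> ?C = ?C \<otimes> conjugate G A ?C"
    using AB by (simp add: conjugate_def m_assoc[symmetric])
  then show "A \<otimes> ?C = ?C \<otimes> A [^] (1 + u)" by (simp only: A)
  have "?C \<otimes> B = conjugate G B (commutator G B A) \<otimes> ?C"
    using AB by (simp add: conjugate_def inv_commutator[OF AB, symmetric] m_assoc)
  then show "?C \<otimes> B = B [^] (1 + u) \<otimes> ?C" by (simp only: B)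
qed (use AB in simp_all)

lemma macdonald_hom_image:
  assumes "group_hom G H h" and "macdonald G A B C u"
  shows "macdonald H (h A) (h B) (h C) u"
proof -
  interpret group_hom G H h by fact
  interpret macdonald G A B C u by fact
  show ?thesis
  proof
    show "h A \<otimes>\<^bsub>H\<^esub> h B = h B \<otimes>\<^bsub>H\<^esub> h A \<otimes>\<^bsub>H\<^esub> h C"
      using arg_cong[OF A_B, of h] by simp
    show "h A \<otimes>\<^bsub>H\<^esub> h C = h C \<otimes>\<^bsub>H\<^esub> h A [^]\<^bsub>H\<^esub> (1 + u)"
      using arg_cong[OF A_C, of h] by (simp add: hom_int_pow)
    show "h C \<otimes>\<^bsub>H\<^esub> h B = h B [^]\<^bsub>H\<^esub> (1 + u) \<otimes>\<^bsub>H\<^esub> h C"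
      using arg_cong[OF C_B, of h] by (simp add: hom_int_pow)
  qed simp_all
qed

lemma (in group) center_normal: "center G \<lhd> G"
proof (rule normal_invI)
  show "subgroup (center G) G"
  proof
    fix x y assume xy: "x \<in> center G" "y \<in> center G"
    have "x \<otimes> y \<otimes> g = g \<otimes> (x \<otimes> y)" if g: "g \<in> carrier G" for g
    proof -
      have "x \<in> carrier G" "y \<in> carrier G" "x \<otimes> g = g \<otimes> x" "y \<otimes> g = g \<otimes> y"
        using xy g unfolding center_def by blast+
      then show ?thesis using g by (metis m_assoc)
    qed
    moreover have "x \<otimes> y \<in> carrier G" using xy unfolding center_def by blast
    ultimately show "x \<otimes> y \<in> center G" unfolding center_def by blast
  next
    fix x assume x: "x \<in> center G"
    have "inv x \<otimes> y = y \<otimes> inv x" if y: "y \<in> carrier G" for y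
    proof -
      have "x \<otimes> y = y \<otimes> x" "x \<in> carrier G" using x y unfolding center_def by blast+
      then show ?thesis
        using y by (intro inv_commute)
    qed
    moreover have "inv x \<in> carrier G" using x unfolding center_def by blast
    ultimately show "inv x \<in> center G" unfolding center_def by blast
  qed (auto simp: center_def)
next
  fix x z assume x: "x \<in> carrier G" and z: "z \<in> center G"
  then have comm: "x \<otimes> z = z \<otimes> x" and "z \<in> carrier G"
    unfolding center_def by (metis (mono_tags, lifting) mem_Collect_eq)+
  then have "x \<otimes> z \<otimes> inv x = z"
    using x m_assoc[of z x "inv x"] unfolding comm by simp
  then show "x \<otimes> z \<otimes> inv x \<in> center G" using z by simp
qed

lemma presented_group_hom:
  assumes "R \<subseteq> carrier free_group \<times> carrier free_group"
  shows "group_hom free_group (presented_group R) (\<lambda>x. relator_kernel R #>\<^bsub>free_group\<^esub> x)"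
  using normal.r_coset_hom_Mod[OF relator_kernel_normal[OF assms]]
    presented_group_is_group[OF assms] free_group_is_group
  by (simp add: group_hom_def group_hom_axioms_def presented_group_def)

lemma presented_group_relation:
  assumes R: "R \<subseteq> carrier free_group \<times> carrier free_group" and xy: "(x, y) \<in> R"
  shows "relator_kernel R #>\<^bsub>free_group\<^esub> x = relator_kernel R #>\<^bsub>free_group\<^esub> y"
proof -
  interpret F: group free_group by (rule free_group_is_group)
  interpret K: normal "relator_kernel R" free_group by (rule relator_kernel_normal[OF R])
  have "x \<otimes>\<^bsub>free_group\<^esub> inv\<^bsub>free_group\<^esub> y \<in> relator_kernel R"
    using xy unfolding relator_kernel_def normal_closure_def by force
  moreover have "x \<in> carrier free_group" "y \<in> carrier free_group" using R xy by auto
  ultimately have "x \<in> relator_kernel R #>\<^bsub>free_group\<^esub> y"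
    by (intro K.rcos_module_rev F.is_group)
  then show ?thesis
    using F.repr_independence K.subgroup_axioms \<open>y \<in> carrier free_group\<close> by metis
qed

lemma free_class_Cons:
  "free_class ((x, e) # w) =
    (if e then free_gen x else inv\<^bsub>free_group\<^esub> free_gen x) \<otimes>\<^bsub>free_group\<^esub> free_class w"
proof -
  interpret F: group free_group by (rule free_group_is_group)
  have "free_class [(x, False)] \<otimes>\<^bsub>free_group\<^esub> free_gen x = free_class []"
    using free_cancel[of "[]" x False "[]"]
    by (simp add: free_gen_def free_group_mult free_class_eq_iff)
  then have "inv\<^bsub>free_group\<^esub> free_gen x = free_class [(x, False)]"
    using free_gen_closed by (intro F.inv_equality) (auto simp: free_group_one free_group_carrier)
  then show ?thesis
    by (simp add: free_gen_def free_group_mult)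
qed

text \<open>Centrality may be tested on the generators, because every class of words is a product
  of them and their inverses.\<close>

lemma presented_group_centerI:
  assumes R: "R \<subseteq> carrier free_group \<times> carrier free_group"
    and z: "z \<in> carrier (presented_group R)"
    and gen: "\<And>x. z \<otimes>\<^bsub>presented_group R\<^esub> presented_gen R x =
                  presented_gen R x \<otimes>\<^bsub>presented_group R\<^esub> z"
  shows "z \<in> center (presented_group R)"
proof -
  define J where "J = presented_group R"
  define \<pi> where "\<pi> = (\<lambda>x. relator_kernel R #>\<^bsub>free_group\<^esub> x)"
  interpret \<pi>: group_hom free_group J \<pi>
    unfolding J_def \<pi>_def by (rule presented_group_hom[OF R])
  have z: "z \<in> carrier J" using z by (simp add: J_def)
  have gen: "z \<otimes>\<^bsub>J\<^esub> \<pi> (free_gen x) = \<pi> (free_gen x) \<otimes>\<^bsub>J\<^esub> z" for x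
    using gen by (simp add: J_def \<pi>_def presented_gen_def)
  have *: "z \<otimes>\<^bsub>J\<^esub> \<pi> (free_class w) = \<pi> (free_class w) \<otimes>\<^bsub>J\<^esub> z" for w
  proof (induction w)
    case Nil
    then show ?case using z \<pi>.hom_one by (simp add: free_group_one)
  next
    case (Cons l w)
    obtain x e where l: "l = (x, e)" by (cases l)
    define y where "y = \<pi> (if e then free_gen x else inv\<^bsub>free_group\<^esub> free_gen x)"
    have w: "\<pi> (free_class w) \<in> carrier J" by (simp add: free_group_carrier)
    have y: "y \<in> carrier J" by (simp add: y_def free_gen_closed)
    have split: "\<pi> (free_class (l # w)) = y \<otimes>\<^bsub>J\<^esub> \<pi> (free_class w)"
      unfolding l free_class_Cons y_def
      by (rule \<pi>.hom_mult) (simp_all add: free_gen_closed, simp add: free_group_carrier)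
    have zy: "z \<otimes>\<^bsub>J\<^esub> y = y \<otimes>\<^bsub>J\<^esub> z"
    proof (cases e)
      case True then show ?thesis by (simp add: y_def gen)
    next
      case False
      then have "y = inv\<^bsub>J\<^esub> \<pi> (free_gen x)" by (simp add: y_def free_gen_closed)
      then show ?thesis
        using \<pi>.H.inv_commute[of "\<pi> (free_gen x)" z] gen[of x] z free_gen_closed[of x] by simp
    qed
    show ?case
      unfolding split using zy z y w Cons.IH by (metis \<pi>.H.m_assoc)
  qed
  have "carrier J = \<pi> ` range free_class"
    by (auto simp: J_def \<pi>_def presented_group_def FactGroup_def RCOSETS_def free_group_carrier)
  then show ?thesis
    using z * by (auto simp: center_def J_def[symmetric])
qed

section \<open>The group J\<close>

lemma
  J_macdonald: "macdonald (J_group m l) (J_A m l) (J_B m l)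
    (commutator (J_group m l) (J_A m l) (J_B m l)) (2 ^ m * l)"
  and J_A_order: "J_A m l [^]\<^bsub>J_group m l\<^esub> (2 ^ (3 * m - 1) :: int) = \<one>\<^bsub>J_group m l\<^esub>"
  and J_B_order: "J_B m l [^]\<^bsub>J_group m l\<^esub> (2 ^ (3 * m - 1) :: int) = \<one>\<^bsub>J_group m l\<^esub>"
proof -
  define \<pi> where "\<pi> = (\<lambda>x. relator_kernel (J_rels m l) #>\<^bsub>free_group\<^esub> x)"
  interpret \<pi>: group_hom free_group "J_group m l" \<pi>
    unfolding J_group_def \<pi>_def by (rule presented_group_hom[OF J_rels_carrier])
  have AB: "J_A m l = \<pi> (free_gen LA)" "J_B m l = \<pi> (free_gen LB)"
    by (simp_all add: J_A_def J_B_def \<pi>_def presented_gen_def)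
  have rel: "\<pi> x = \<pi> y" if "(x, y) \<in> J_rels m l" for x y
    unfolding \<pi>_def by (rule presented_group_relation[OF J_rels_carrier that])
  note [simp] = free_gen_closed
  show "macdonald (J_group m l) (J_A m l) (J_B m l) (commutator (J_group m l) (J_A m l) (J_B m l))
      (2 ^ m * l)"
  proof (rule \<pi>.H.macdonaldI[OF J_A_closed J_B_closed])
    show "conjugate (J_group m l) (J_A m l) (commutator (J_group m l) (J_A m l) (J_B m l)) =
        J_A m l [^]\<^bsub>J_group m l\<^esub> (1 + 2 ^ m * l)"
      using rel[of "conjugate free_group (free_gen LA) (commutator free_group (free_gen LA) (free_gen LB))"
          "free_gen LA [^]\<^bsub>free_group\<^esub> J_alpha m l"]
      by (simp add: J_rels_def Let_def AB \<pi>.hom_conjugate \<pi>.hom_commutator \<pi>.hom_int_pow J_alpha_def)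
    show "conjugate (J_group m l) (J_B m l) (commutator (J_group m l) (J_B m l) (J_A m l)) =
        J_B m l [^]\<^bsub>J_group m l\<^esub> (1 + 2 ^ m * l)"
      using rel[of "conjugate free_group (free_gen LB) (commutator free_group (free_gen LB) (free_gen LA))"
          "free_gen LB [^]\<^bsub>free_group\<^esub> J_alpha m l"]
      by (simp add: J_rels_def Let_def AB \<pi>.hom_conjugate \<pi>.hom_commutator \<pi>.hom_int_pow J_alpha_def)
  qed
  have P: "(2 ^ (3 * m - 1) :: int) = int (2 ^ (3 * m - 1))" by simp
  show "J_A m l [^]\<^bsub>J_group m l\<^esub> (2 ^ (3 * m - 1) :: int) = \<one>\<^bsub>J_group m l\<^esub>"
    using rel[of "free_gen LA [^]\<^bsub>free_group\<^esub> (2 ^ (3 * m - 1) :: nat)" "\<one>\<^bsub>free_group\<^esub>"]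
    unfolding P int_pow_int by (simp add: J_rels_def Let_def AB \<pi>.hom_nat_pow)
  show "J_B m l [^]\<^bsub>J_group m l\<^esub> (2 ^ (3 * m - 1) :: int) = \<one>\<^bsub>J_group m l\<^esub>"
    using rel[of "free_gen LB [^]\<^bsub>free_group\<^esub> (2 ^ (3 * m - 1) :: nat)" "\<one>\<^bsub>free_group\<^esub>"]
    unfolding P int_pow_int by (simp add: J_rels_def Let_def AB \<pi>.hom_nat_pow)
qed

lemma J_centerI:
  assumes "z \<in> carrier (J_group m l)"
    and "z \<otimes>\<^bsub>J_group m l\<^esub> J_A m l = J_A m l \<otimes>\<^bsub>J_group m l\<^esub> z"
    and "z \<otimes>\<^bsub>J_group m l\<^esub> J_B m l = J_B m l \<otimes>\<^bsub>J_group m l\<^esub> z"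
  shows "z \<in> center (J_group m l)"
  unfolding J_group_def
proof (rule presented_group_centerI[OF J_rels_carrier])
  fix x
  show "z \<otimes>\<^bsub>presented_group (J_rels m l)\<^esub> presented_gen (J_rels m l) x =
    presented_gen (J_rels m l) x \<otimes>\<^bsub>presented_group (J_rels m l)\<^esub> z"
    using assms(2,3) by (cases x) (simp_all add: J_group_def J_A_def J_B_def)
qed (use assms(1) in \<open>simp add: J_group_def\<close>)

lemma J_central_powers:
  fixes m :: nat and l :: int
  assumes "m \<ge> 1" and "odd l"
  defines "J \<equiv> J_group m l" and "A \<equiv> J_A m l" and "B \<equiv> J_B m l"
  defines "C \<equiv> commutator J A B" and "N \<equiv> 2 ^ (2 * m - 1) :: int"
  shows "A [^]\<^bsub>J\<^esub> N \<in> center J" and "B [^]\<^bsub>J\<^esub> N \<in> center J" and "C [^]\<^bsub>J\<^esub> N \<in> center J"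
proof -
  interpret macdonald J A B C "2 ^ m * l"
    unfolding C_def J_def A_def B_def by (rule J_macdonald)
  interpret swapped: macdonald J B A "inv\<^bsub>J\<^esub> C" "2 ^ m * l" by (rule swapped)
  note orders = J_A_order[of m l, folded J_def A_def] J_B_order[of m l, folded J_def B_def]
  note centerI = J_centerI[of _ m l, folded J_def A_def B_def]
  have pow_self: "x [^]\<^bsub>J\<^esub> N \<otimes>\<^bsub>J\<^esub> x = x \<otimes>\<^bsub>J\<^esub> x [^]\<^bsub>J\<^esub> N" if "x \<in> carrier J" for x
    using that int_pow_mult[of x N 1] int_pow_mult[of x 1 N] by (simp add: add.commute)
  show "A [^]\<^bsub>J\<^esub> N \<in> center J"
    using A_pow_commute_B[OF assms(1,2) refl orders] pow_self[OF A]
    by (intro centerI) (simp_all add: N_def)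
  show "B [^]\<^bsub>J\<^esub> N \<in> center J"
    using swapped.A_pow_commute_B[OF assms(1,2) refl orders(2,1)] pow_self[OF B]
    by (intro centerI) (simp_all add: N_def)
  have "inv\<^bsub>J\<^esub> C [^]\<^bsub>J\<^esub> N \<otimes>\<^bsub>J\<^esub> B = B \<otimes>\<^bsub>J\<^esub> inv\<^bsub>J\<^esub> C [^]\<^bsub>J\<^esub> N"
    unfolding N_def by (rule swapped.C_pow_commute_A[OF assms(1) refl orders(2)])
  then have "inv\<^bsub>J\<^esub> (C [^]\<^bsub>J\<^esub> N) \<otimes>\<^bsub>J\<^esub> B = B \<otimes>\<^bsub>J\<^esub> inv\<^bsub>J\<^esub> (C [^]\<^bsub>J\<^esub> N)"
    by (simp add: int_pow_inv)
  then have "C [^]\<^bsub>J\<^esub> N \<otimes>\<^bsub>J\<^esub> B = B \<otimes>\<^bsub>J\<^esub> C [^]\<^bsub>J\<^esub> N"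
    using inv_commute[of "inv\<^bsub>J\<^esub> (C [^]\<^bsub>J\<^esub> N)" B] by simp
  then show "C [^]\<^bsub>J\<^esub> N \<in> center J"
    using C_pow_commute_A[OF assms(1) refl orders(1)]
    by (intro centerI) (simp_all add: N_def)
qed

theorem proposition3p4:
  fixes m :: nat and l i j k a b c :: int
  assumes "m \<ge> 1" and "odd l"
  shows
    "let J = J_group m l; A = J_A m l; B = J_B m l; C = commutator J A B;
         s = (2::int) ^ (m - 1);
         eA = 2 * s * l * (j * phi a - phi i * b + i * c - k * a);
         eB = 2 * s * l * (i * phi b - phi j * a + k * b + j * (i * b - a * b - c));
         eC = i * b - j * a
              + 2 * s * l * (phi a * (phi j + j * b) - phi i * (phi b + j * b)
                             + i * j * c - k * a * b)
     in commutator J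
          (A [^]\<^bsub>J\<^esub> i \<otimes>\<^bsub>J\<^esub> B [^]\<^bsub>J\<^esub> j \<otimes>\<^bsub>J\<^esub> C [^]\<^bsub>J\<^esub> k)
          (A [^]\<^bsub>J\<^esub> a \<otimes>\<^bsub>J\<^esub> B [^]\<^bsub>J\<^esub> b \<otimes>\<^bsub>J\<^esub> C [^]\<^bsub>J\<^esub> c)
          <#\<^bsub>J\<^esub> center J
        = (A [^]\<^bsub>J\<^esub> eA \<otimes>\<^bsub>J\<^esub> B [^]\<^bsub>J\<^esub> eB \<otimes>\<^bsub>J\<^esub> C [^]\<^bsub>J\<^esub> eC)
          <#\<^bsub>J\<^esub> center J"
proof -
  define J A B where "J = J_group m l" and "A = J_A m l" and "B = J_B m l"
  define C where "C = commutator J A B"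
  define v where "v = 2 ^ (m - 1) * l"
  have u_eq: "2 * v = 2 ^ m * l"
    using assms(1) by (simp add: v_def power_Suc[symmetric] mult.assoc[symmetric] del: power_Suc)
  interpret J: macdonald J A B C "2 * v"
    unfolding u_eq C_def J_def A_def B_def by (rule J_macdonald)
  interpret Z: normal "center J" J by (rule J.center_normal)
  define Q where "Q = J Mod center J"
  define q where "q = (\<lambda>x. center J #>\<^bsub>J\<^esub> x)"
  interpret q: group_hom J Q q
    using Z.r_coset_hom_Mod Z.factorgroup_is_group J.is_group
    by (simp add: group_hom_def group_hom_axioms_def Q_def q_def)
  have exponent: "q x [^]\<^bsub>Q\<^esub> (2 * (v * v)) = \<one>\<^bsub>Q\<^esub>"
    if x: "x \<in> carrier J" "x [^]\<^bsub>J\<^esub> (2 ^ (2 * m - 1) :: int) \<in> center J" for x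
  proof -
    have "2 * m - 1 = Suc ((m - 1) + (m - 1))" using assms(1) by simp
    then have "(2::int) ^ (2 * m - 1) = 2 * (2 ^ (m - 1) * 2 ^ (m - 1))"
      by (simp only: power_Suc power_add)
    then have "2 * (v * v) = 2 ^ (2 * m - 1) * (l * l)"
      by (simp add: v_def)
    moreover have "q (x [^]\<^bsub>J\<^esub> (2 ^ (2 * m - 1) :: int)) = \<one>\<^bsub>Q\<^esub>"
      using x(2) Z.rcos_const[OF J.is_group] by (simp add: q_def Q_def FactGroup_def)
    ultimately show ?thesis
      using x(1) by (simp add: q.hom_int_pow q.H.int_pow_pow[symmetric])
  qed
  \<comment> \<open>The central powers of \<open>A\<close>, \<open>B\<close> and \<open>C\<close> become trivial in the quotient, so the collection
    formulas apply there.\<close>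
  interpret Q: macdonald_mod_center Q "q A" "q B" "q C" v
  proof (unfold_locales; (rule exponent)?)
    note central = J_central_powers[OF assms, folded J_def A_def B_def, folded C_def]
    show "A [^]\<^bsub>J\<^esub> (2 ^ (2 * m - 1) :: int) \<in> center J" "B [^]\<^bsub>J\<^esub> (2 ^ (2 * m - 1) :: int) \<in> center J"
      "C [^]\<^bsub>J\<^esub> (2 ^ (2 * m - 1) :: int) \<in> center J"
      by (rule central)+
  qed (use macdonald_hom_image[OF q.group_hom_axioms J.macdonald_axioms] in
      \<open>simp_all add: macdonald_def macdonald_axioms_def\<close>)
  have coset: "x <#\<^bsub>J\<^esub> center J = q x" if "x \<in> carrier J" for x
    using Z.coset_eq that by (simp add: q_def)
  show ?thesis
    unfolding Let_def J_def[symmetric] A_def[symmetric] B_def[symmetric]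
    unfolding C_def[symmetric]
    using Q.commutator_normal_form[of i j k a b c]
    by (simp add: coset q.hom_commutator q.hom_int_pow v_def mult.assoc)
qed

end
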